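(* Let $\alpha\in[g,G]$. The $\varphi_\alpha$-invariant probability measure $\nu_\alpha$ on $I_\alpha$ satisfies $d\nu_\alpha=h_\alpha\,d\lambda$ with density $h_\alpha$ as follows. When $g\le\alpha\le1$, $$h_\alpha(x)=\frac1{3\log G}\cdot\begin{cases}\frac1{x+G+1}&\text{if }x\in\left[\alpha-2,\frac{\alpha-1}{2-\alpha}\right)\\ \frac1{x+G+1}+\frac1{x+G-1}-\frac1{x+1}&\text{if }x\in\left[\frac{\alpha-1}{2-\alpha},\frac{1-\alpha}\alpha\right)\\ \frac1{x+G-1}&\text{if }x\in\left[\frac{1-\alpha}\alpha,\alpha\right).\end{cases}$$ When $1\le\alpha\le G$, $$h_\alpha(x)=\frac1{3\log G}\cdot\begin{cases}\frac1{x+G+1}&\text{if }x\in\left[\alpha-2,\frac{1-\alpha}\alpha\right)\\ \frac1{x+1}&\text{if }x\in\left[\frac{1-\alpha}\alpha,\frac{\alpha-1}{2-\alpha}\right)\\ \frac1{x+G-1}&\text{if }x\in\left[\frac{\alpha-1}{2-\alpha},\alpha\right).\end{cases}$$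
   Context: $g=\frac12(\sqrt5-1)$, $G=\frac12(\sqrt5+1)$, $[\cdot]$ in the formula for $d_\alpha$ is the integer part (floor), and $\lambda$ is Lebesgue measure on $\mathbb R$. $I_\alpha=[\alpha-2,\alpha)$. For $x\ne0$, $d_\alpha(x)=2\left[\frac1{2|x|}+\frac{1-\alpha}2\right]+1$ and $\varphi_\alpha(x)=\frac1{|x|}-d_\alpha(x)$, with $\varphi_\alpha(0)=0$; the same formulas at $x=\alpha$ define $\varphi_\alpha(\alpha)=\frac1\alpha-d_\alpha(\alpha)$. For $g<\alpha<G$, $$\Omega_\alpha=\big(I_\alpha\times[0,2-G)\big)\cup\big((\varphi_\alpha(\alpha),\alpha)\times(2-G,1]\big)\cup\big([\varphi_\alpha(\alpha-2),\alpha)\times[1,G)\big),$$ while $\Omega_g=\big([g-2,g)\times[0,1-g)\big)\cup\big([\frac{g-1}{2-g},g)\times[1,G)\big)$ and $\Omega_G=[G-2,G)\times[0,1)$. Let $d\mu_\alpha=(1+xy)^{-2}dx\,dy$ on $\Omega_\alpha$, which has total mass $3\log G$, and $\tilde\mu_\alpha=(3\log G)^{-1}\mu_\alpha$. The probability measure $\nu_\alpha$ on the Borel sets of $I_\alpha$ is defined by $\nu_\alpha(E)=\tilde\mu_\alpha(\{(x,y)\in\Omega_\alpha:x\in E\})$; it is $\varphi_\alpha$-invariant. *)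

theory Defs
  imports "HOL-Probability.Probability"
begin

definition golden_g :: real where
  "golden_g = (sqrt 5 - 1) / 2"

definition golden_G :: real where
  "golden_G = (sqrt 5 + 1) / 2"

definition alpha_interval :: "real \<Rightarrow> real set" where
  "alpha_interval \<alpha> = {\<alpha> - 2..<\<alpha>}"

definition alpha_digit :: "real \<Rightarrow> real \<Rightarrow> int" where
  "alpha_digit \<alpha> x = 2 * \<lfloor>1 / (2 * \<bar>x\<bar>) + (1 - \<alpha>) / 2\<rfloor> + 1"

text \<open>The map is defined on all reals, so that it can also be evaluated at the excluded
  right endpoint \<open>\<alpha>\<close> of the interval.\<close>

definition phi :: "real \<Rightarrow> real \<Rightarrow> real" where
  "phi \<alpha> x = (if x = 0 then 0 else 1 / \<bar>x\<bar> - real_of_int (alpha_digit \<alpha> x))"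

text \<open>The natural extension domain; only parameters between \<open>golden_g\<close> and \<open>golden_G\<close> are
  meaningful.\<close>

definition Omega :: "real \<Rightarrow> (real \<times> real) set" where
  "Omega \<alpha> =
    (if \<alpha> = golden_g then
       {golden_g - 2..<golden_g} \<times> {0..<1 - golden_g} \<union>
       {(golden_g - 1) / (2 - golden_g)..<golden_g} \<times> {1..<golden_G}
     else if \<alpha> = golden_G then
       {golden_G - 2..<golden_G} \<times> {0..<1}
     else
       alpha_interval \<alpha> \<times> {0..<2 - golden_G} \<union>
       {phi \<alpha> \<alpha><..<\<alpha>} \<times> {2 - golden_G<..1} \<union>
       {phi \<alpha> (\<alpha> - 2)..<\<alpha>} \<times> {1..<golden_G})"

definition mu :: "real \<Rightarrow> (real \<times> real) measure" where
  "mu \<alpha> = density (restrict_space lborel (Omega \<alpha>)) (\<lambda>(x, y). ennreal (1 / (1 + x * y)\<^sup>2))"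

definition mu_normalized :: "real \<Rightarrow> (real \<times> real) measure" where
  "mu_normalized \<alpha> = scale_measure (ennreal (1 / (3 * ln golden_G))) (mu \<alpha>)"

text \<open>The pushforward under the first projection: a Borel set \<open>E\<close> of the interval gets the
  normalized mass of \<open>{(x, y) \<in> Omega \<alpha>. x \<in> E}\<close>.\<close>

definition nu :: "real \<Rightarrow> real measure" where
  "nu \<alpha> = distr (mu_normalized \<alpha>) (restrict_space borel (alpha_interval \<alpha>)) fst"

definition density_le_1 :: "real \<Rightarrow> real \<Rightarrow> real" where
  "density_le_1 \<alpha> x = 1 / (3 * ln golden_G) *
    (if x \<in> {\<alpha> - 2..<(\<alpha> - 1) / (2 - \<alpha>)} then
       1 / (x + golden_G + 1)
     else if x \<in> {(\<alpha> - 1) / (2 - \<alpha>)..<(1 - \<alpha>) / \<alpha>} then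
       1 / (x + golden_G + 1) + 1 / (x + golden_G - 1) - 1 / (x + 1)
     else if x \<in> {(1 - \<alpha>) / \<alpha>..<\<alpha>} then
       1 / (x + golden_G - 1)
     else 0)"

definition density_ge_1 :: "real \<Rightarrow> real \<Rightarrow> real" where
  "density_ge_1 \<alpha> x = 1 / (3 * ln golden_G) *
    (if x \<in> {\<alpha> - 2..<(1 - \<alpha>) / \<alpha>} then
       1 / (x + golden_G + 1)
     else if x \<in> {(1 - \<alpha>) / \<alpha>..<(\<alpha> - 1) / (2 - \<alpha>)} then
       1 / (x + 1)
     else if x \<in> {(\<alpha> - 1) / (2 - \<alpha>)..<\<alpha>} then
       1 / (x + golden_G - 1)
     else 0)"

end

theory Submission
  imports Defs "HOL-Real_Asymp.Real_Asymp"
begin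

text \<open>With \<open>P = (\<alpha> - 1) / (2 - \<alpha>)\<close> and \<open>R = (1 - \<alpha>) / \<alpha>\<close>, almost every fibre of the domain is
  \<open>[0, 2 - G)\<close>, together with \<open>(2 - G, 1]\<close> if \<open>R < x\<close> and with \<open>[1, G)\<close> if \<open>P \<le> x\<close>, including at
  the two end points of the parameter range. Integrating over the fibres gives one formula for the
  density, of which the two stated ones are the cases \<open>P \<le> R\<close> and \<open>R \<le> P\<close>.

  For invariance, substitute \<open>x = \<plusminus>1/z\<close> with \<open>z = y + d\<close> and \<open>d\<close> an odd digit. The sum over the
  inverse branches telescopes in \<open>d\<close>: the gap between the contributions of \<open>1/z\<close> and
  \<open>-1/(z + 2)\<close> is filled exactly once because \<open>R < 1/z\<close> is complementary to \<open>P \<le> -1/(z + 2)\<close>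
  and \<open>P \<le> 1/z\<close> is complementary to \<open>R < -1/(z + 2)\<close>.\<close>

subsection \<open>Constants and the two cut points\<close>

lemma golden_G_square: "golden_G * golden_G = golden_G + 1"
proof -
  have "sqrt 5 * sqrt 5 = (5::real)" by simp
  then show ?thesis unfolding golden_G_def by (simp add: field_simps)
qed

lemma golden_g_eq: "golden_g = golden_G - 1"
  by (simp add: golden_g_def golden_G_def field_simps)

lemma golden_G_bounds: "8/5 < golden_G" "golden_G < 5/3"
proof -
  have "(11/5::real) < sqrt 5" by (rule real_less_rsqrt) (simp add: power2_eq_square)
  then show "8/5 < golden_G" by (simp add: golden_G_def)
  have "sqrt 5 < (7/3::real)" by (rule real_less_lsqrt) (simp_all add: power2_eq_square)
  then show "golden_G < 5/3" by (simp add: golden_G_def)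
qed

text \<open>For parameters strictly between \<open>golden_g\<close> and \<open>golden_G\<close> the
  two cuts are the values of \<open>phi \<alpha>\<close> at \<open>\<alpha> - 2\<close> and at
  \<open>\<alpha>\<close>. The closed forms also describe the domains at the two end parameters,
  where \<open>Omega\<close> has cases of its own.\<close>

definition lower_cut :: "real \<Rightarrow> real" where
  "lower_cut \<alpha> = (\<alpha> - 1) / (2 - \<alpha>)"

definition upper_cut :: "real \<Rightarrow> real" where
  "upper_cut \<alpha> = (1 - \<alpha>) / \<alpha>"

text \<open>The integral of \<open>1 / (1 + x * y)^2\<close> over \<open>[0, t)\<close> is
  \<open>1 / (x + 1 / t)\<close>, and \<open>1 / t\<close> is \<open>golden_G + 1\<close>,
  \<open>1\<close>, \<open>golden_G - 1\<close> for the heights \<open>2 - golden_G\<close>,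
  \<open>1\<close>, \<open>golden_G\<close> of the domain.\<close>

definition fibre_mass :: "real \<Rightarrow> real \<Rightarrow> real" where
  "fibre_mass \<alpha> x = 1 / (x + golden_G + 1)
     + (if upper_cut \<alpha> < x then 1 / (x + 1) - 1 / (x + golden_G + 1) else 0)
     + (if lower_cut \<alpha> \<le> x then 1 / (x + golden_G - 1) - 1 / (x + 1) else 0)"

text \<open>Vanishing outside the interval makes inverse branches that leave it contribute nothing,
  so sums over branches carry no side conditions.\<close>

definition weight :: "real \<Rightarrow> real \<Rightarrow> real" where
  "weight \<alpha> x = indicator (alpha_interval \<alpha>) x * fibre_mass \<alpha> x"

text \<open>\<open>golden_g\<close> and \<open>golden_G\<close> are the positive roots of
  \<open>t * t + t = 1\<close> and \<open>t * t = t + 1\<close>; the two quadratic bounds are the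
  form in which the parameter range enters most later estimates.\<close>

lemma alpha_bounds:
  assumes "\<alpha> \<in> {golden_g..golden_G}"
  shows "3/5 < \<alpha>" "\<alpha> < 5/3" "1 \<le> \<alpha> * \<alpha> + \<alpha>" "\<alpha> * \<alpha> \<le> \<alpha> + 1"
proof -
  have a: "golden_G - 1 \<le> \<alpha>" "\<alpha> \<le> golden_G"
    using assms by (auto simp: golden_g_eq)
  then show "3/5 < \<alpha>" "\<alpha> < 5/3" using golden_G_bounds by auto
  have "(golden_G - 1) * golden_G \<le> \<alpha> * (\<alpha> + 1)"
    using a golden_G_bounds by (intro mult_mono) auto
  then show "1 \<le> \<alpha> * \<alpha> + \<alpha>" using golden_G_square by (simp add: algebra_simps)
  have "\<alpha> * (\<alpha> - 1) \<le> golden_G * (golden_G - 1)"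
  \<comment> \<open>\<open>\<alpha> - 1\<close> may be negative, so monotonicity of products is
    applied only when \<open>\<alpha> > 1\<close>.\<close>
  proof (cases "\<alpha> \<le> 1")
    case True
    then have "\<alpha> * (\<alpha> - 1) \<le> 0" using \<open>3/5 < \<alpha>\<close> by (simp add: mult_nonneg_nonpos)
    also have "0 \<le> golden_G * (golden_G - 1)" using golden_G_bounds by simp
    finally show ?thesis .
  next
    case False
    then show ?thesis using a golden_G_bounds by (intro mult_mono) auto
  qed
  then show "\<alpha> * \<alpha> \<le> \<alpha> + 1" using golden_G_square by (simp add: algebra_simps)
qed

text \<open>The last two bounds keep \<open>x + 1\<close> and \<open>x + golden_G - 1\<close>
  positive wherever the corresponding summand of \<open>fibre_mass\<close> is active.\<close>

lemma cut_bounds: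
  assumes "\<alpha> \<in> {golden_g..golden_G}"
  shows "\<alpha> - 2 \<le> upper_cut \<alpha>" "upper_cut \<alpha> \<le> \<alpha>" "\<alpha> - 2 \<le> lower_cut \<alpha>" "lower_cut \<alpha> \<le> \<alpha>"
    "golden_G - 2 \<le> upper_cut \<alpha>" "golden_G - 2 < lower_cut \<alpha>"
proof -
  note b = alpha_bounds[OF assms] golden_G_bounds golden_G_square
  have a: "golden_G - 1 \<le> \<alpha>" "\<alpha> \<le> golden_G"
    using assms by (auto simp: golden_g_eq)
  show "\<alpha> - 2 \<le> upper_cut \<alpha>" "upper_cut \<alpha> \<le> \<alpha>"
    using b by (simp_all add: upper_cut_def field_simps)
  \<comment> \<open>Clearing the denominator leaves
    \<open>0 \<le> \<alpha>^2 - 3 * \<alpha> + 3\<close>, which is this square plus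
    \<open>3/4\<close>.\<close>
  have "0 \<le> (\<alpha> - 3/2)\<^sup>2" by simp
  then show "\<alpha> - 2 \<le> lower_cut \<alpha>"
    using b by (simp add: lower_cut_def field_simps power2_eq_square)
  show "lower_cut \<alpha> \<le> \<alpha>"
    using b by (simp add: lower_cut_def field_simps)
  have "(golden_G - 1) * \<alpha> \<le> (golden_G - 1) * golden_G"
    using a b by (intro mult_left_mono) auto
  then show "golden_G - 2 \<le> upper_cut \<alpha>"
    using b by (simp add: upper_cut_def field_simps)
  have "(golden_G - 1) * (golden_G - 1) \<le> (golden_G - 1) * \<alpha>"
    using a b by (intro mult_left_mono) auto
  then show "golden_G - 2 < lower_cut \<alpha>"
    using b by (simp add: lower_cut_def field_simps)
qed

lemma fibre_mass_nonneg:
  assumes "\<alpha> \<in> {golden_g..golden_G}" "\<alpha> - 2 \<le> x"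
  shows "0 \<le> fibre_mass \<alpha> x"
proof -
  note b = alpha_bounds[OF assms(1)] cut_bounds[OF assms(1)] golden_G_bounds
  have "0 \<le> 1 / (x + golden_G + 1)" using b assms(2) by simp
  moreover have "1 / (x + golden_G + 1) \<le> 1 / (x + 1)" if "upper_cut \<alpha> < x"
    using b that by (intro divide_left_mono) (auto intro!: mult_pos_pos)
  moreover have "1 / (x + 1) \<le> 1 / (x + golden_G - 1)" if "lower_cut \<alpha> \<le> x"
    using b that by (intro divide_left_mono) (auto intro!: mult_pos_pos)
  ultimately show ?thesis unfolding fibre_mass_def by (auto split: if_splits)
qed

lemma weight_nonneg:
  assumes "\<alpha> \<in> {golden_g..golden_G}"
  shows "0 \<le> weight \<alpha> x"
  using fibre_mass_nonneg[OF assms] by (auto simp: weight_def alpha_interval_def indicator_def)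

lemma weight_measurable [measurable]: "weight \<alpha> \<in> borel_measurable borel"
  unfolding weight_def fibre_mass_def alpha_interval_def by measurable

section \<open>Transport of fibre masses along single inverse branches\<close>

text \<open>The mass of \<open>[0, t)\<close> in the fibre over \<open>\<plusminus>1/z\<close>, with \<open>c = 1/t\<close>, is moved by the
  inverse branch to the mass of \<open>[z, z + t)\<close>, respectively \<open>[z - t, z)\<close>, for \<open>dw/w\<^sup>2\<close>.\<close>

lemma inverse_branch_pos:
  fixes z t c :: real
  assumes "0 < z" "0 < t" "c * t = 1"
  shows "1 / (1 / z + c) / z\<^sup>2 = 1 / z - 1 / (z + t)"
proof -
  have "c = 1 / t" using assms by (simp add: field_simps)
  then have "1 / z + c = (z + t) / (z * t)" using assms by (simp add: field_simps)
  then have "1 / (1 / z + c) / z\<^sup>2 = z * t / (z + t) / z\<^sup>2" by simp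
  also have "\<dots> = 1 / z - 1 / (z + t)" using assms(1,2) by (simp add: divide_simps power2_eq_square) (simp add: algebra_simps)?
  finally show ?thesis .
qed

lemma inverse_branch_neg:
  fixes z t c :: real
  assumes "0 < z" "0 < t" "t < z" "c * t = 1"
  shows "1 / (- 1 / z + c) / z\<^sup>2 = 1 / (z - t) - 1 / z"
proof -
  have "c = 1 / t" using assms by (simp add: field_simps)
  then have "- 1 / z + c = (z - t) / (z * t)" using assms by (simp add: field_simps)
  then have "1 / (- 1 / z + c) / z\<^sup>2 = z * t / (z - t) / z\<^sup>2" by simp
  also have "\<dots> = 1 / (z - t) - 1 / z" using assms(1-3) by (simp add: divide_simps power2_eq_square) (simp add: algebra_simps)?
  finally show ?thesis .
qed

lemma golden_inverses: "(golden_G + 1) * (2 - golden_G) = 1" "(golden_G - 1) * golden_G = 1"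
  using golden_G_square by (simp_all add: algebra_simps)

text \<open>Splits the quotient into terms of the shape \<open>1 / (x + c) / s\<close>, to which the
  inverse branch identities apply literally.\<close>

lemma weight_divide:
  assumes "x \<in> alpha_interval \<alpha>"
  shows "weight \<alpha> x / s = 1 / (x + (golden_G + 1)) / s
     + (if upper_cut \<alpha> < x then 1 / (x + 1) / s - 1 / (x + (golden_G + 1)) / s else 0)
     + (if lower_cut \<alpha> \<le> x then 1 / (x + (golden_G - 1)) / s - 1 / (x + 1) / s else 0)"
proof -
  have eq: "x + golden_G + 1 = x + (golden_G + 1)" "x + golden_G - 1 = x + (golden_G - 1)" by auto
  show ?thesis
    unfolding weight_def fibre_mass_def eq using assms
    by (simp add: add_divide_distrib[of _ _ s] diff_divide_distrib[of _ _ s] del: add_diff_eq)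
qed

text \<open>For \<open>z > 0\<close> this is the \<open>dw/w^2\<close> mass of the part of
  \<open>[z, \<infinity>)\<close> that the fibre over \<open>1 / z\<close>, translated by
  \<open>z\<close>, leaves uncovered.\<close>

definition tail :: "real \<Rightarrow> real \<Rightarrow> real" where
  "tail \<alpha> z = 1 / (z + (2 - golden_G))
     - (if upper_cut \<alpha> < 1 / z then 1 / (z + (2 - golden_G)) - 1 / (z + 1) else 0)
     - (if lower_cut \<alpha> \<le> 1 / z then 1 / (z + 1) - 1 / (z + golden_G) else 0)"

lemma weight_pos:
  assumes "\<alpha> \<in> {golden_g..golden_G}" "0 < z" "1 / z < \<alpha>"
  shows "weight \<alpha> (1 / z) / z\<^sup>2 = 1 / z - tail \<alpha> z"
proof -
  note b = alpha_bounds[OF assms(1)] golden_G_bounds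
  have "0 < 1 / z" using assms by simp
  then have i: "1 / z \<in> alpha_interval \<alpha>"
    using assms b unfolding alpha_interval_def atLeastLessThan_iff by linarith
  \<comment> \<open>The three instances have \<open>t = 2 - golden_G\<close>, \<open>1\<close> and
    \<open>golden_G\<close>.\<close>
  have 1: "1 / (1 / z + (golden_G + 1)) / z\<^sup>2 = 1 / z - 1 / (z + (2 - golden_G))"
    using assms b golden_inverses by (intro inverse_branch_pos) auto
  have 2: "1 / (1 / z + 1) / z\<^sup>2 = 1 / z - 1 / (z + 1)"
    using assms b by (intro inverse_branch_pos) auto
  have 3: "1 / (1 / z + (golden_G - 1)) / z\<^sup>2 = 1 / z - 1 / (z + golden_G)"
    using assms b golden_inverses by (intro inverse_branch_pos) auto
  show ?thesis
    unfolding weight_divide[OF i] 1 2 3 tail_def by simp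
qed

text \<open>After clearing denominators all four conditions are linear in \<open>z\<close>, and
  replacing \<open>z\<close> by \<open>z + 2\<close> turns the inequality for one cut into the
  negation of that for the other.\<close>

lemma cuts_complementary:
  assumes "\<alpha> \<in> {golden_g..golden_G}" "0 < z"
  shows "upper_cut \<alpha> < 1 / z \<longleftrightarrow> \<not> lower_cut \<alpha> \<le> - 1 / (z + 2)"
    "lower_cut \<alpha> \<le> 1 / z \<longleftrightarrow> \<not> upper_cut \<alpha> < - 1 / (z + 2)"
proof -
  note b = alpha_bounds[OF assms(1)]
  have "upper_cut \<alpha> < 1 / z \<longleftrightarrow> (1 - \<alpha>) * z < \<alpha>" "lower_cut \<alpha> \<le> 1 / z \<longleftrightarrow> (\<alpha> - 1) * z \<le> 2 - \<alpha>"
    using b assms by (simp_all add: upper_cut_def lower_cut_def field_simps)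
  moreover have "lower_cut \<alpha> \<le> - 1 / (z + 2) \<longleftrightarrow> (\<alpha> - 1) * (z + 2) \<le> - (2 - \<alpha>)"
    "upper_cut \<alpha> < - 1 / (z + 2) \<longleftrightarrow> (1 - \<alpha>) * (z + 2) < - \<alpha>"
    using b assms by (simp_all add: upper_cut_def lower_cut_def divide_le_eq le_divide_eq less_divide_eq divide_less_eq pos_divide_le_eq pos_divide_less_eq)
      (simp_all add: field_simps)
  ultimately show "upper_cut \<alpha> < 1 / z \<longleftrightarrow> \<not> lower_cut \<alpha> \<le> - 1 / (z + 2)"
    "lower_cut \<alpha> \<le> 1 / z \<longleftrightarrow> \<not> upper_cut \<alpha> < - 1 / (z + 2)"
    by (auto simp: algebra_simps)
qed

text \<open>Reflection carries \<open>[0, t)\<close> to \<open>[z - t, z)\<close>, which must stay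
  to the right of 0. The conditional hypotheses demand this only of the pieces present over
  \<open>- 1 / z\<close>.\<close>

lemma weight_neg:
  assumes "\<alpha> \<in> {golden_g..golden_G}" "2 - golden_G < z" "1 / z \<le> 2 - \<alpha>"
    and "upper_cut \<alpha> < - 1 / z \<Longrightarrow> 1 < z" "lower_cut \<alpha> \<le> - 1 / z \<Longrightarrow> golden_G < z"
  shows "weight \<alpha> (- 1 / z) / z\<^sup>2 = 1 / (z - (2 - golden_G)) - 1 / z
     + (if upper_cut \<alpha> < - 1 / z then 1 / (z - 1) - 1 / (z - (2 - golden_G)) else 0)
     + (if lower_cut \<alpha> \<le> - 1 / z then 1 / (z - golden_G) - 1 / (z - 1) else 0)"
proof -
  note b = alpha_bounds[OF assms(1)] golden_G_bounds
  have z: "0 < z" using assms b by linarith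
  then have "- 1 / z < 0" "- 1 / z = - (1 / z)" by auto
  then have i: "- 1 / z \<in> alpha_interval \<alpha>"
    using assms b unfolding alpha_interval_def atLeastLessThan_iff by linarith
  have 1: "1 / (- 1 / z + (golden_G + 1)) / z\<^sup>2 = 1 / (z - (2 - golden_G)) - 1 / z"
    using assms b z golden_inverses by (intro inverse_branch_neg) auto
  have 2: "1 / (- 1 / z + 1) / z\<^sup>2 = 1 / (z - 1) - 1 / z" if "1 < z"
    using b z that by (intro inverse_branch_neg) auto
  have 3: "1 / (- 1 / z + (golden_G - 1)) / z\<^sup>2 = 1 / (z - golden_G) - 1 / z" if "golden_G < z"
    using assms b z golden_inverses that by (intro inverse_branch_neg) auto
  show ?thesis
    unfolding weight_divide[OF i] using 1 2 3 assms(4,5) b by (auto split: if_splits)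
qed

text \<open>The breakpoints of the fibre over \<open>- 1 / (z + 2)\<close>, reflected from
  \<open>z + 2\<close>, are \<open>z + golden_G\<close>, \<open>z + 1\<close> and
  \<open>z + 2 - golden_G\<close>, the same as those of the fibre over \<open>1 / z\<close>
  translated by \<open>z\<close>. By complementarity of the cuts its pieces fill exactly the gaps
  below \<open>z + 2\<close>.\<close>

lemma weight_neg_tail:
  assumes "\<alpha> \<in> {golden_g..golden_G}" "0 < z" "golden_G < z + 2" "1 / (z + 2) \<le> 2 - \<alpha>"
  shows "weight \<alpha> (- 1 / (z + 2)) / (z + 2)\<^sup>2 = tail \<alpha> z - 1 / (z + 2)"
proof -
  have "weight \<alpha> (- 1 / (z + 2)) / (z + 2)\<^sup>2 = 1 / (z + 2 - (2 - golden_G)) - 1 / (z + 2)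
     + (if upper_cut \<alpha> < - 1 / (z + 2) then 1 / (z + 2 - 1) - 1 / (z + 2 - (2 - golden_G)) else 0)
     + (if lower_cut \<alpha> \<le> - 1 / (z + 2) then 1 / (z + 2 - golden_G) - 1 / (z + 2 - 1) else 0)"
    using assms golden_G_bounds by (intro weight_neg) auto
  moreover have "z + 2 - (2 - golden_G) = z + golden_G" "z + 2 - 1 = z + 1"
    "z + 2 - golden_G = z + (2 - golden_G)" by auto
  ultimately show ?thesis
    unfolding cuts_complementary[OF assms(1,2)] tail_def by (simp only: if_not_P simp_thms split: if_split) argo
qed

subsection \<open>The transfer operator\<close>

lemma tail_tendsto: "(\<lambda>n. tail \<alpha> (y + 2 * real n + 1)) \<longlonglongrightarrow> 0"
proof -
  have inv: "(\<lambda>n. 1 / (y + 2 * real n + 1 + t)) \<longlonglongrightarrow> 0" for t :: real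
    by real_asymp
  have inv1: "(\<lambda>n. 1 / (y + 2 * real n + 1 + t) - 1 / (y + 2 * real n + 1 + t')) \<longlonglongrightarrow> 0" for t t' :: real
    using tendsto_diff[OF inv inv] by simp
  \<comment> \<open>Squeezing by the absolute value of \<open>f\<close> avoids deciding which cut
    conditions hold for large \<open>n\<close>.\<close>
  have cond: "(\<lambda>n. if Q n then f n else 0) \<longlonglongrightarrow> 0" if "f \<longlonglongrightarrow> 0" for Q and f :: "nat \<Rightarrow> real"
    by (rule tendsto_rabs_zero_cancel, rule tendsto_sandwich[OF _ _ tendsto_const tendsto_rabs_zero[OF that]]) auto
  have "(\<lambda>n. tail \<alpha> (y + 2 * real n + 1)) \<longlonglongrightarrow> 0 - 0 - 0"
    unfolding tail_def
    by (rule tendsto_diff[OF tendsto_diff[OF inv[where t = "2 - golden_G"] cond[OF inv1]] cond[OF inv1]])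
  then show ?thesis by simp
qed

text \<open>The contribution to the transfer operator of the two inverse branches with digit \<open>d\<close>,
  where \<open>z = d + y\<close>.\<close>

definition branch_term :: "real \<Rightarrow> real \<Rightarrow> real" where
  "branch_term \<alpha> z = (if 0 < z then (weight \<alpha> (1 / z) + weight \<alpha> (- 1 / z)) / z\<^sup>2 else 0)"

lemma branch_term_nonneg:
  assumes "\<alpha> \<in> {golden_g..golden_G}"
  shows "0 \<le> branch_term \<alpha> z"
  using weight_nonneg[OF assms] by (simp add: branch_term_def)

lemma branch_term_measurable [measurable]: "branch_term \<alpha> \<in> borel_measurable borel"
  unfolding branch_term_def by measurable

text \<open>At \<open>z = 1 + \<alpha>\<close> the first two claims are the quadratic bounds on
  \<open>\<alpha>\<close>. For \<open>y > \<alpha> - 2\<close> and a digit \<open>d \<ge> 3\<close>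
  the point \<open>z = y + d\<close> exceeds \<open>1 + \<alpha>\<close>, so both branches with
  digit \<open>d\<close> stay inside the interval.\<close>

lemma inverse_less_alpha:
  assumes "\<alpha> \<in> {golden_g..golden_G}" "1 + \<alpha> < z"
  shows "1 / z < \<alpha>" "1 / z \<le> 2 - \<alpha>" "golden_G < z"
proof -
  note b = alpha_bounds[OF assms(1)] golden_G_bounds
  have "\<alpha> * (1 + \<alpha>) < \<alpha> * z" using b assms(2) by (intro mult_strict_left_mono) auto
  then show "1 / z < \<alpha>" using b assms(2) by (simp add: field_simps)
  have "(2 - \<alpha>) * (1 + \<alpha>) \<le> (2 - \<alpha>) * z" using b assms(2) by (intro mult_left_mono) auto
  then show "1 / z \<le> 2 - \<alpha>" using b assms(2) by (simp add: field_simps)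
  show "golden_G < z" using assms by (simp add: golden_g_eq)
qed

text \<open>The positive branch gives \<open>1 / (z + 2) - tail \<alpha> (z + 2)\<close> and the
  negative one \<open>tail \<alpha> z - 1 / (z + 2)\<close>.\<close>

lemma branch_term_eq:
  assumes "\<alpha> \<in> {golden_g..golden_G}" "0 < z" "\<alpha> - 1 < z"
  shows "branch_term \<alpha> (z + 2) = tail \<alpha> z - tail \<alpha> (z + 2)"
proof -
  have i: "1 / (z + 2) < \<alpha>" "1 / (z + 2) \<le> 2 - \<alpha>" "golden_G < z + 2"
    using inverse_less_alpha[OF assms(1), of "z + 2"] assms(3) by auto
  show ?thesis
    using weight_pos[OF assms(1) _ i(1)] weight_neg_tail[OF assms(1,2) i(3,2)] assms(2)
    unfolding branch_term_def add_divide_distrib by simp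
qed

text \<open>The negated claim becomes \<open>2 - \<alpha> \<le> (1 - \<alpha>) * z\<close>, which
  forces \<open>\<alpha> < 1\<close> and then contradicts \<open>z < c\<close>. The parameter
  \<open>c\<close> lets the lemma serve both digit 1 and digit 3.\<close>

lemma not_lower_cut_le:
  assumes "\<alpha> \<in> {golden_g..golden_G}" "0 < z" "z < c" "(1 - \<alpha>) * c \<le> 2 - \<alpha>"
  shows "\<not> lower_cut \<alpha> \<le> - 1 / z"
proof
  note b = alpha_bounds[OF assms(1)]
  assume "lower_cut \<alpha> \<le> - 1 / z"
  then have "lower_cut \<alpha> * z \<le> - 1" using assms by (simp add: field_simps)
  then have 1: "2 - \<alpha> \<le> (1 - \<alpha>) * z" using b by (simp add: lower_cut_def field_simps)
  then have "0 < (1 - \<alpha>) * z" using b by linarith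
  then have "0 < 1 - \<alpha>" using assms(2) by (simp add: zero_less_mult_iff)
  then have "(1 - \<alpha>) * z < (1 - \<alpha>) * c" using assms(3) by simp
  then show False using 1 assms(4) by linarith
qed

lemma not_upper_cut_less:
  assumes "\<alpha> \<in> {golden_g..golden_G}" "0 < z" "z \<le> c" "(\<alpha> - 1) * c \<le> \<alpha>"
  shows "\<not> upper_cut \<alpha> < - 1 / z"
proof
  note b = alpha_bounds[OF assms(1)]
  assume "upper_cut \<alpha> < - 1 / z"
  then have "upper_cut \<alpha> * z < - 1" using assms by (simp add: field_simps)
  then have 1: "\<alpha> < (\<alpha> - 1) * z" using b by (simp add: upper_cut_def field_simps)
  then have "0 < (\<alpha> - 1) * z" using b by linarith
  then have "0 < \<alpha> - 1" using assms(2) by (simp add: zero_less_mult_iff)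
  then have "(\<alpha> - 1) * z \<le> (\<alpha> - 1) * c" using assms(3) by simp
  then show False using 1 assms(4) by linarith
qed

text \<open>The branches with digit 1 tile what the branches with larger digits leave uncovered.\<close>

lemma branch_term_first:
  assumes "\<alpha> \<in> {golden_g..golden_G}" "\<alpha> - 2 < y" "y < \<alpha>"
  shows "branch_term \<alpha> (y + 1) + weight \<alpha> (- 1 / (y + 3)) / (y + 3)\<^sup>2 + 1 / (y + 3) = weight \<alpha> y"
proof -
  note b = alpha_bounds[OF assms(1)] golden_G_bounds cut_bounds[OF assms(1)]
  have i: "1 / (y + 3) < \<alpha>" "1 / (y + 3) \<le> 2 - \<alpha>" "golden_G < y + 3"
    using inverse_less_alpha[OF assms(1), of "y + 3"] assms(2) by auto
  have y: "y \<in> alpha_interval \<alpha>" using assms by (simp add: alpha_interval_def)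
  have upper: "upper_cut \<alpha> < y \<longleftrightarrow> 1 < \<alpha> * (y + 1)" 
    using b by (simp add: upper_cut_def field_simps)
  have lower: "lower_cut \<alpha> \<le> y \<longleftrightarrow> 1 \<le> (2 - \<alpha>) * (y + 1)"
    using b by (simp add: lower_cut_def field_simps)
  \<comment> \<open>Since \<open>upper_cut \<alpha> + 1 = 1 / \<alpha>\<close> and
    \<open>lower_cut \<alpha> + 1 = 1 / (2 - \<alpha>)\<close>, the preimages
    \<open>1 / (y + 1)\<close> and \<open>- 1 / (y + 1)\<close> lie in the interval exactly when
    \<open>y\<close> has passed the respective cut.\<close>
  have pos: "0 < y + 1 \<and> 1 / (y + 1) < \<alpha> \<longleftrightarrow> upper_cut \<alpha> < y"
  proof
    assume "upper_cut \<alpha> < y"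
    then have "1 < \<alpha> * (y + 1)" using upper by simp
    moreover have "0 < \<alpha>" using b by linarith
    ultimately have "0 < y + 1" by (smt (verit) mult_nonneg_nonpos)
    then show "0 < y + 1 \<and> 1 / (y + 1) < \<alpha>" using \<open>1 < \<alpha> * (y + 1)\<close> by (simp add: field_simps)
  qed (auto simp: upper field_simps)
  have neg: "0 < y + 1 \<and> 1 / (y + 1) \<le> 2 - \<alpha> \<longleftrightarrow> lower_cut \<alpha> \<le> y"
  proof
    assume "lower_cut \<alpha> \<le> y"
    then have 1: "1 \<le> (2 - \<alpha>) * (y + 1)" using lower by simp
    have "0 < y + 1"
    proof (rule ccontr)
      assume "\<not> 0 < y + 1"
      then have "(2 - \<alpha>) * (y + 1) \<le> 0" using b by (intro mult_nonneg_nonpos) auto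
      then show False using 1 by simp
    qed
    then show "0 < y + 1 \<and> 1 / (y + 1) \<le> 2 - \<alpha>" using 1 by (simp add: field_simps)
  qed (auto simp: lower field_simps)
  \<comment> \<open>Past the upper cut \<open>y + 1\<close> is positive and the telescoping identity
    applies. Otherwise \<open>y\<close> is so small that only the lowest piece of the fibre over
    \<open>- 1 / (y + 3)\<close> is present.\<close>
  have third: "weight \<alpha> (- 1 / (y + 3)) / (y + 3)\<^sup>2 + 1 / (y + 3)
      = (if upper_cut \<alpha> < y then tail \<alpha> (y + 1) else 1 / (y + golden_G + 1))"
  proof (cases "upper_cut \<alpha> < y")
    case True
    then show ?thesis
      using weight_neg_tail[OF assms(1), of "y + 1"] i pos by (simp add: add.commute)
  next
    case False
    then have y1: "\<alpha> * (y + 1) \<le> 1" using upper by simp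
    have 1: "\<not> lower_cut \<alpha> \<le> - 1 / (y + 3)"
      using not_lower_cut_le[OF assms(1), of "y + 3" "3 + \<alpha>"] b i assms by (simp add: algebra_simps)
    have 2: "\<not> upper_cut \<alpha> < - 1 / (y + 3)"
      using not_upper_cut_less[OF assms(1), of "y + 3" "2 + 1 / \<alpha>"] b i y1 by (simp add: field_simps)
    have "y + 3 - (2 - golden_G) = y + golden_G + 1" by simp
    then show ?thesis
      using False 1 2 weight_neg[OF assms(1), of "y + 3"] i b by simp
  qed
  have first_pos: "0 < y + 1 \<Longrightarrow> weight \<alpha> (1 / (y + 1)) / (y + 1)\<^sup>2
      = (if upper_cut \<alpha> < y then 1 / (y + 1) - tail \<alpha> (y + 1) else 0)"
  proof (cases "upper_cut \<alpha> < y")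
    case True
    then show ?thesis using pos weight_pos[OF assms(1), of "y + 1"] by simp
  next
    case False
    assume "0 < y + 1"
    then have "1 / (y + 1) \<notin> alpha_interval \<alpha>"
      using False pos by (auto simp: alpha_interval_def)
    then show ?thesis using False by (simp add: weight_def)
  qed
  have first_neg: "0 < y + 1 \<Longrightarrow> weight \<alpha> (- 1 / (y + 1)) / (y + 1)\<^sup>2
      = (if lower_cut \<alpha> \<le> y then 1 / (y + golden_G - 1) - 1 / (y + 1) else 0)"
  proof (cases "lower_cut \<alpha> \<le> y")
    case True
    then have y1: "0 < y + 1" "1 / (y + 1) \<le> 2 - \<alpha>" using neg by auto
    have 1: "\<not> lower_cut \<alpha> \<le> - 1 / (y + 1)"
    proof (rule not_lower_cut_le[OF assms(1)])
      have "0 \<le> (\<alpha> - 1 / 2)\<^sup>2" by simp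
      then show "(1 - \<alpha>) * (1 + \<alpha>) \<le> 2 - \<alpha>" by (simp add: power2_eq_square algebra_simps)
    qed (use y1 assms in auto)
    have 2: "\<not> upper_cut \<alpha> < - 1 / (y + 1)"
      using not_upper_cut_less[OF assms(1), of "y + 1" "1 + \<alpha>"] b y1 assms by (simp add: algebra_simps)
    have "y + 1 - (2 - golden_G) = y + golden_G - 1" by simp
    moreover have "2 - golden_G < y + 1"
      using True b by linarith
    ultimately show ?thesis
      using True 1 2 weight_neg[OF assms(1), of "y + 1"] y1 by simp
  next
    case False
    assume "0 < y + 1"
    then have "- 1 / (y + 1) \<notin> alpha_interval \<alpha>"
      using False neg by (auto simp: alpha_interval_def)
    then show ?thesis using False by (simp add: weight_def)
  qed
  have "\<not> 0 < y + 1 \<Longrightarrow> \<not> upper_cut \<alpha> < y \<and> \<not> lower_cut \<alpha> \<le> y"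
    using pos neg by auto
  \<comment> \<open>Past the upper cut the tails cancel and \<open>1 / (y + 1)\<close> remains,
    otherwise \<open>1 / (y + golden_G + 1)\<close>; the negative branch supplies the summand of
    \<open>fibre_mass\<close> governed by the lower cut.\<close>
  then show ?thesis
    using first_pos first_neg third y
    by (auto simp: branch_term_def add_divide_distrib weight_def fibre_mass_def)
qed

text \<open>The series is the Perron-Frobenius operator of \<open>phi \<alpha>\<close> applied to
  \<open>weight \<alpha>\<close>, so the weight is a fixed point of it.\<close>

lemma transfer_operator_weight:
  assumes "\<alpha> \<in> {golden_g..golden_G}" "\<alpha> - 2 < y" "y < \<alpha>"
  shows "(\<lambda>n. branch_term \<alpha> (y + 2 * real n + 1)) sums weight \<alpha> y"
proof -
  \<comment> \<open>\<open>q n\<close> is the total contribution of the digits above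
    \<open>2 * n + 1\<close>. The value at 0 is set apart because \<open>y + 1\<close> may be
    nonpositive, where \<open>tail\<close> does not represent that remainder.\<close>
  define q where "q n = (if n = 0 then weight \<alpha> (- 1 / (y + 3)) / (y + 3)\<^sup>2 + 1 / (y + 3)
    else tail \<alpha> (y + 2 * real n + 1))" for n
  have i: "1 / (y + 3) < \<alpha>" "golden_G < y + 3"
    using inverse_less_alpha[OF assms(1), of "y + 3"] assms(2) by auto
  have "branch_term \<alpha> (y + 3) = q 0 - q 1"
    using weight_pos[OF assms(1) _ i(1)] i golden_G_bounds
    by (simp add: branch_term_def add_divide_distrib q_def add.commute)
  moreover have "branch_term \<alpha> (y + 2 * real (Suc n) + 1) = q n - q (Suc n)" if "0 < n" for n
  proof -
    have "2 \<le> 2 * real n" using that by simp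
    then have "0 < y + 2 * real n + 1" "\<alpha> - 1 < y + 2 * real n + 1"
      using assms alpha_bounds[OF assms(1)] by linarith+
    moreover have "y + 2 * real (Suc n) + 1 = y + 2 * real n + 1 + 2" by simp
    ultimately show ?thesis
      using branch_term_eq[OF assms(1), of "y + 2 * real n + 1"] that unfolding q_def by simp
  qed
  ultimately have step: "branch_term \<alpha> (y + 2 * real (Suc n) + 1) = q n - q (Suc n)" for n
    by (cases "n = 0") (simp_all add: add.commute)
  have "q \<longlonglongrightarrow> 0"
    using tail_tendsto[of \<alpha> y] by (rule Lim_transform_eventually)
      (auto simp: q_def eventually_sequentially intro!: exI[of _ 1])
  from telescope_sums'[OF this] have "(\<lambda>n. branch_term \<alpha> (y + 2 * real (Suc n) + 1)) sums q 0"
    unfolding step by simp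
  then have "(\<lambda>n. branch_term \<alpha> (y + 2 * real n + 1)) sums (q 0 + branch_term \<alpha> (y + 1))"
    using sums_Suc[of "\<lambda>n. branch_term \<alpha> (y + 2 * real n + 1)" "q 0"] by simp
  then show ?thesis
    using branch_term_first[OF assms] by (simp add: q_def add.commute add.left_commute)
qed

subsection \<open>The fibres of the natural extension domain\<close>

text \<open>Both end points have digit 1: the strict bounds on \<open>\<alpha>\<close> become strict
  quadratic inequalities that keep the argument of the floor below 1.\<close>

lemma phi_endpoints:
  assumes "golden_g < \<alpha>" "\<alpha> < golden_G"
  shows "phi \<alpha> \<alpha> = upper_cut \<alpha>" "phi \<alpha> (\<alpha> - 2) = lower_cut \<alpha>"
proof -
  have a: "\<alpha> \<in> {golden_g..golden_G}" using assms by auto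
  note b = alpha_bounds[OF a] golden_G_bounds
  have a': "golden_G - 1 < \<alpha>" using assms by (simp add: golden_g_eq)
  have "(golden_G - 1) * golden_G < \<alpha> * (\<alpha> + 1)"
    using a' b by (intro mult_strict_mono) auto
  then have sq: "1 < \<alpha> * \<alpha> + \<alpha>" using golden_inverses by (simp add: algebra_simps)
  have "0 < (golden_G - \<alpha>) * (\<alpha> + golden_G - 1)"
    using assms b by (intro mult_pos_pos) auto
  also have "\<dots> = \<alpha> + 1 - \<alpha> * \<alpha>" using golden_G_square by (simp add: algebra_simps)
  finally have sq': "\<alpha> * \<alpha> < \<alpha> + 1" by simp
  have "\<lfloor>1 / (2 * \<bar>\<alpha>\<bar>) + (1 - \<alpha>) / 2\<rfloor> = 0"
    using b sq sq' by (intro floor_unique) (simp_all add: field_simps)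
  then show "phi \<alpha> \<alpha> = upper_cut \<alpha>"
    using b by (simp add: phi_def alpha_digit_def upper_cut_def field_simps)
  have "0 \<le> (\<alpha> - 3/2)\<^sup>2" by simp
  then have "\<alpha> * 6 \<le> 6 + \<alpha> * (\<alpha> * 2)" by (simp add: power2_eq_square algebra_simps)
  then have "\<lfloor>1 / (2 * \<bar>\<alpha> - 2\<bar>) + (1 - \<alpha>) / 2\<rfloor> = 0"
    using b sq sq' by (intro floor_unique) (simp_all add: field_simps)
  then show "phi \<alpha> (\<alpha> - 2) = lower_cut \<alpha>"
    using b by (simp add: phi_def alpha_digit_def lower_cut_def field_simps)
qed

text \<open>At \<open>golden_g\<close> the upper cut is \<open>\<alpha>\<close>, so the middle piece
  is empty. At \<open>golden_G\<close> the lower cut is \<open>\<alpha>\<close>, so the top piece is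
  empty, while the upper cut is \<open>\<alpha> - 2\<close>, which is why that abscissa is excluded.
  Avoiding the four boundary heights makes open and closed ends interchangeable.\<close>

lemma Omega_fibre:
  assumes "\<alpha> \<in> {golden_g..golden_G}" "x \<noteq> \<alpha> - 2" "y \<notin> {0, 2 - golden_G, 1, golden_G}"
  shows "(x, y) \<in> Omega \<alpha> \<longleftrightarrow> x \<in> alpha_interval \<alpha> \<and>
    (y \<in> {0..2 - golden_G} \<or> upper_cut \<alpha> < x \<and> y \<in> {2 - golden_G..1}
      \<or> lower_cut \<alpha> \<le> x \<and> y \<in> {1..golden_G})"
proof -
  note b = golden_G_bounds cut_bounds[OF assms(1)]
  have gG: "golden_g \<noteq> golden_G" by (simp add: golden_g_eq)
  consider "\<alpha> = golden_g" | "\<alpha> = golden_G" | "golden_g < \<alpha>" "\<alpha> < golden_G"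
    using assms(1) by force
  then show ?thesis
  proof cases
    case 1
    have "upper_cut \<alpha> = \<alpha>"
      using golden_G_square b unfolding upper_cut_def 1 golden_g_eq by (simp add: field_simps)
    moreover have "Omega \<alpha> = {\<alpha> - 2..<\<alpha>} \<times> {0..<2 - golden_G} \<union> {lower_cut \<alpha>..<\<alpha>} \<times> {1..<golden_G}"
      unfolding Omega_def 1 lower_cut_def by (simp add: golden_g_eq)
    ultimately show ?thesis
      using assms(2,3) b(1-6) by (simp add: alpha_interval_def) argo
  next
    case 2
    have "upper_cut \<alpha> = \<alpha> - 2" "lower_cut \<alpha> = \<alpha>"
      using golden_G_square b unfolding upper_cut_def lower_cut_def 2
      by (simp_all add: field_simps)
    moreover have "Omega \<alpha> = {\<alpha> - 2..<\<alpha>} \<times> {0..<1}"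
      unfolding Omega_def 2 using gG by simp
    ultimately show ?thesis
      using assms(2,3) b(1-6) by (simp add: alpha_interval_def) argo
  next
    case 3
    have "Omega \<alpha> = {\<alpha> - 2..<\<alpha>} \<times> {0..<2 - golden_G} \<union> {upper_cut \<alpha><..<\<alpha>} \<times> {2 - golden_G<..1}
      \<union> {lower_cut \<alpha>..<\<alpha>} \<times> {1..<golden_G}"
      unfolding Omega_def using 3 phi_endpoints[OF 3] by (simp add: alpha_interval_def)
    then show ?thesis
      using assms(2,3) b(1-6) by (simp add: alpha_interval_def) argo
  qed
qed

lemma Omega_subset:
  assumes "\<alpha> \<in> {golden_g..golden_G}"
  shows "Omega \<alpha> \<subseteq> alpha_interval \<alpha> \<times> UNIV"
proof -
  consider "\<alpha> = golden_g" | "\<alpha> = golden_G" | "golden_g < \<alpha>" "\<alpha> < golden_G"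
    using assms by force
  then show ?thesis
    using cut_bounds[OF assms] phi_endpoints[of \<alpha>]
    by cases (auto simp: Omega_def alpha_interval_def lower_cut_def)
qed

lemma Omega_measurable [measurable]: "Omega \<alpha> \<in> sets borel"
proof -
  have "Omega \<alpha> \<in> sets (borel \<Otimes>\<^sub>M borel)"
    unfolding Omega_def alpha_interval_def
    by (simp split: if_split)
  then show ?thesis unfolding borel_prod .
qed

text \<open>The antiderivative \<open>y / (1 + x * y)\<close> also covers \<open>x = 0\<close>. As
  \<open>1 + x * y\<close> is affine in \<open>y\<close>, positivity at both ends gives it in
  between.\<close>

lemma nn_integral_inverse_square:
  fixes x a b :: real
  assumes "a \<le> b" "0 < 1 + x * a" "0 < 1 + x * b"
  shows "(\<integral>\<^sup>+y. ennreal (1 / (1 + x * y)\<^sup>2) * indicator {a..b} y \<partial>lborel)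
    = ennreal (b / (1 + x * b) - a / (1 + x * a))"
proof (rule nn_integral_FTC_Icc[where F = "\<lambda>y. y / (1 + x * y)"])
  fix y assume y: "y \<in> {a..b}"
  have "0 < 1 + x * y"
  proof (cases "0 \<le> x")
    case True
    then have "x * a \<le> x * y" using y by (intro mult_left_mono) auto
    then show ?thesis using assms by simp
  next
    case False
    then have "x * b \<le> x * y" using y by (intro mult_left_mono_neg) auto
    then show ?thesis using assms by simp
  qed
  then show "((\<lambda>y. y / (1 + x * y)) has_real_derivative 1 / (1 + x * y)\<^sup>2) (at y)"
    by (auto intro!: derivative_eq_intros simp: power2_eq_square field_simps)
qed (use assms in auto)

lemma fibre_integral:
  assumes "\<alpha> \<in> {golden_g..golden_G}" "x \<noteq> \<alpha> - 2"
  shows "(\<integral>\<^sup>+y. ennreal (1 / (1 + x * y)\<^sup>2) * indicator (Omega \<alpha>) (x, y) \<partial>lborel)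
    = ennreal (weight \<alpha> x)"
proof (cases "x \<in> alpha_interval \<alpha>")
  case False
  then have "(x, y) \<notin> Omega \<alpha>" for y using Omega_subset[OF assms(1)] by auto
  then show ?thesis using False by (simp add: weight_def)
next
  case True
  note b = alpha_bounds[OF assms(1)] golden_G_bounds cut_bounds[OF assms(1)]
  define f where "f y = ennreal (1 / (1 + x * y)\<^sup>2)" for y
  have f [measurable]: "f \<in> borel_measurable borel" unfolding f_def by measurable
  have x: "golden_G - 3 \<le> x" using True assms(1) by (auto simp: alpha_interval_def golden_g_eq)
  have "AE y in lborel. \<forall>c\<in>{0, 2 - golden_G, 1, golden_G}. y \<noteq> c"
    by (subst AE_ball_countable) (auto intro: AE_lborel_singleton)
  then have "AE y in lborel. f y * indicator (Omega \<alpha>) (x, y) = f y * indicator {0..2 - golden_G} y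
    + (if upper_cut \<alpha> < x then f y * indicator {2 - golden_G..1} y else 0)
    + (if lower_cut \<alpha> \<le> x then f y * indicator {1..golden_G} y else 0)"
  proof eventually_elim
    case (elim y)
    then have "y \<notin> {0, 2 - golden_G, 1, golden_G}" by auto
    from Omega_fibre[OF assms this] True elim b show ?case
      by (auto simp: indicator_def)
  qed
  then have "(\<integral>\<^sup>+y. f y * indicator (Omega \<alpha>) (x, y) \<partial>lborel)
    = (\<integral>\<^sup>+y. f y * indicator {0..2 - golden_G} y
    + (if upper_cut \<alpha> < x then f y * indicator {2 - golden_G..1} y else 0)
    + (if lower_cut \<alpha> \<le> x then f y * indicator {1..golden_G} y else 0) \<partial>lborel)"
    by (rule nn_integral_cong_AE)
  also have "\<dots> = (\<integral>\<^sup>+y. f y * indicator {0..2 - golden_G} y \<partial>lborel)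
    + (if upper_cut \<alpha> < x then \<integral>\<^sup>+y. f y * indicator {2 - golden_G..1} y \<partial>lborel else 0)
    + (if lower_cut \<alpha> \<le> x then \<integral>\<^sup>+y. f y * indicator {1..golden_G} y \<partial>lborel else 0)"
    by (auto simp: nn_integral_add)
  also have "(\<integral>\<^sup>+y. f y * indicator {0..2 - golden_G} y \<partial>lborel) = ennreal (1 / (x + golden_G + 1))"
  proof -
    have pos: "0 < x + golden_G + 1" using x b by linarith
    \<comment> \<open>This factorization turns \<open>t / (1 + x * t)\<close> into
      \<open>1 / (x + 1 / t)\<close> for \<open>t = 2 - golden_G\<close>.\<close>
    have eq: "1 + x * (2 - golden_G) = (2 - golden_G) * (x + golden_G + 1)"
      using golden_G_square by (simp add: algebra_simps)
    show ?thesis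
      unfolding f_def using b pos
      by (subst nn_integral_inverse_square) (auto simp: eq)
  qed
  also have "(if upper_cut \<alpha> < x then \<integral>\<^sup>+y. f y * indicator {2 - golden_G..1} y \<partial>lborel else 0)
    = ennreal (if upper_cut \<alpha> < x then 1 / (x + 1) - 1 / (x + golden_G + 1) else 0)"
  proof (cases "upper_cut \<alpha> < x")
    case True
    have pos: "0 < x + golden_G + 1" using x b by linarith
    have eq: "1 + x * (2 - golden_G) = (2 - golden_G) * (x + golden_G + 1)"
      using golden_G_square by (simp add: algebra_simps)
    show ?thesis
      unfolding f_def using b pos True
      by (subst nn_integral_inverse_square) (auto simp: eq add.commute)
  qed simp
  also have "(if lower_cut \<alpha> \<le> x then \<integral>\<^sup>+y. f y * indicator {1..golden_G} y \<partial>lborel else 0)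
    = ennreal (if lower_cut \<alpha> \<le> x then 1 / (x + golden_G - 1) - 1 / (x + 1) else 0)"
  proof (cases "lower_cut \<alpha> \<le> x")
    case True
    then have pos: "0 < x + golden_G - 1" using b by linarith
    have eq: "1 + x * golden_G = golden_G * (x + golden_G - 1)"
      using golden_G_square by (simp add: algebra_simps)
    show ?thesis
      unfolding f_def using b pos True
      by (subst nn_integral_inverse_square) (auto simp: eq add.commute)
  qed simp
  also have "ennreal (1 / (x + golden_G + 1))
    + ennreal (if upper_cut \<alpha> < x then 1 / (x + 1) - 1 / (x + golden_G + 1) else 0)
    + ennreal (if lower_cut \<alpha> \<le> x then 1 / (x + golden_G - 1) - 1 / (x + 1) else 0)
    = ennreal (weight \<alpha> x)"
  proof -
    have "0 \<le> 1 / (x + golden_G + 1)" using x b by simp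
    moreover have "1 / (x + golden_G + 1) \<le> 1 / (x + 1)" if "upper_cut \<alpha> < x"
      using b that by (intro divide_left_mono) (auto intro!: mult_pos_pos)
    moreover have "1 / (x + 1) \<le> 1 / (x + golden_G - 1)" if "lower_cut \<alpha> \<le> x"
      using b that by (intro divide_left_mono) (auto intro!: mult_pos_pos)
    ultimately show ?thesis
      using True by (auto simp: weight_def fibre_mass_def ennreal_plus[symmetric] simp del: ennreal_plus)
  qed
  finally show ?thesis by (simp add: f_def)
qed

section \<open>Density and total mass of the projected measure\<close>

lemma sets_nu [measurable_cong]: "sets (nu \<alpha>) = sets (restrict_space borel (alpha_interval \<alpha>))"
  by (simp add: nu_def)

lemma space_nu [simp]: "space (nu \<alpha>) = alpha_interval \<alpha>"
  by (simp add: nu_def space_restrict_space)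

lemma alpha_interval_measurable [measurable]: "alpha_interval \<alpha> \<in> sets borel"
  by (simp add: alpha_interval_def)

lemma sets_nu_iff: "A \<in> sets (nu \<alpha>) \<longleftrightarrow> A \<in> sets borel \<and> A \<subseteq> alpha_interval \<alpha>"
  by (simp add: sets_nu sets_restrict_space_iff conj_commute)

text \<open>Tonelli with the integral over \<open>y\<close> inside reduces the planar mass to the
  fibre integrals, which are known off the null set \<open>{\<alpha> - 2}\<close>.\<close>

lemma emeasure_nu:
  assumes "\<alpha> \<in> {golden_g..golden_G}" "A \<in> sets (nu \<alpha>)"
  shows "emeasure (nu \<alpha>) A = ennreal (1 / (3 * ln golden_G))
    * (\<integral>\<^sup>+x. ennreal (weight \<alpha> x) * indicator A x \<partial>lborel)"
proof -
  have A [measurable]: "A \<in> sets borel" and "A \<subseteq> alpha_interval \<alpha>"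
    using assms(2) by (auto simp: sets_nu_iff)
  have sp: "space (mu_normalized \<alpha>) = Omega \<alpha>"
    "sets (mu_normalized \<alpha>) = sets (restrict_space borel (Omega \<alpha>))"
    by (simp_all add: mu_normalized_def mu_def space_scale_measure space_restrict_space
      cong: sets_restrict_space_cong)
  have fst_borel: "fst \<in> borel_measurable (borel :: (real \<times> real) measure)"
    by (simp add: borel_prod[symmetric])
  have fst: "fst \<in> measurable (mu_normalized \<alpha>) (restrict_space borel (alpha_interval \<alpha>))"
    using Omega_subset[OF assms(1)] fst_borel
    by (intro measurable_restrict_space2)
      (auto simp: sp cong: measurable_cong_sets intro: measurable_restrict_space1)
  define f where "f = (\<lambda>p. ennreal (1 / (1 + fst p * snd p)\<^sup>2) :: ennreal)"
  have f [measurable]: "f \<in> borel_measurable (borel \<Otimes>\<^sub>M borel)" "f \<in> borel_measurable borel"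
    by (simp_all add: f_def borel_prod[symmetric])
  define B where "B = fst -` A \<inter> Omega \<alpha>"
  have B: "B \<in> sets borel" 
    using measurable_sets[OF fst_borel A] by (auto simp: B_def)
  have "emeasure (nu \<alpha>) A = emeasure (mu_normalized \<alpha>) B"
    using assms(2) fst unfolding sets_nu by (simp add: nu_def emeasure_distr sp B_def)
  also have "\<dots> = ennreal (1 / (3 * ln golden_G)) * emeasure (mu \<alpha>) B"
    by (simp add: mu_normalized_def)
  also have "emeasure (mu \<alpha>) B = (\<integral>\<^sup>+p. f p * indicator B p \<partial>restrict_space lborel (Omega \<alpha>))"
  proof -
    have "B \<in> sets (restrict_space lborel (Omega \<alpha>))"
      using B by (auto simp: sets_restrict_space_iff B_def)
    moreover have "mu \<alpha> = density (restrict_space lborel (Omega \<alpha>)) f"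
      by (simp add: mu_def f_def split_beta')
    ultimately show ?thesis
      by (simp add: emeasure_density measurable_restrict_space1)
  qed
  also have "\<dots> = (\<integral>\<^sup>+p. f p * indicator (Omega \<alpha>) p * indicator A (fst p) \<partial>lborel)"
    by (subst nn_integral_restrict_space)
      (auto intro!: nn_integral_cong simp: B_def indicator_def)
  also have "\<dots> = (\<integral>\<^sup>+p. f p * indicator (Omega \<alpha>) p * indicator A (fst p) \<partial>(lborel \<Otimes>\<^sub>M lborel))"
    by (simp add: lborel_prod)
  also have "\<dots> = (\<integral>\<^sup>+x. \<integral>\<^sup>+y. f (x, y) * indicator (Omega \<alpha>) (x, y) * indicator A x \<partial>lborel \<partial>lborel)"
    using Omega_measurable[of \<alpha>] by (subst lborel.nn_integral_fst[symmetric]) (auto simp: borel_prod[symmetric])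
  also have "\<dots> = (\<integral>\<^sup>+x. ennreal (weight \<alpha> x) * indicator A x \<partial>lborel)"
  proof (rule nn_integral_cong_AE)
    have m: "(\<lambda>y. f (x, y) * indicator (Omega \<alpha>) (x, y)) \<in> borel_measurable borel" for x
      using Omega_measurable[of \<alpha>] by (simp add: borel_prod[symmetric])
    show "AE x in lborel. (\<integral>\<^sup>+y. f (x, y) * indicator (Omega \<alpha>) (x, y) * indicator A x \<partial>lborel)
      = ennreal (weight \<alpha> x) * indicator A x"
      using AE_lborel_singleton[of "\<alpha> - 2"]
    proof eventually_elim
      case (elim x)
      have "(\<integral>\<^sup>+y. f (x, y) * indicator (Omega \<alpha>) (x, y) * indicator A x \<partial>lborel)
        = (\<integral>\<^sup>+y. f (x, y) * indicator (Omega \<alpha>) (x, y) \<partial>lborel) * indicator A x"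
        using m by (intro nn_integral_multc) simp
      then show ?case using fibre_integral[OF assms(1) elim] by (simp add: f_def)
    qed
  qed
  finally show ?thesis .
qed

text \<open>Agreement is asked only almost everywhere because the half-open pieces of the stated
  densities and the strict inequality in \<open>fibre_mass\<close> can disagree at
  \<open>upper_cut \<alpha>\<close>.\<close>

lemma nu_eq_density:
  assumes "\<alpha> \<in> {golden_g..golden_G}" "h \<in> borel_measurable borel"
    and "AE x in lborel. x \<in> alpha_interval \<alpha> \<longrightarrow> h x = 1 / (3 * ln golden_G) * fibre_mass \<alpha> x"
  shows "nu \<alpha> = density (restrict_space lborel (alpha_interval \<alpha>)) (\<lambda>x. ennreal (h x))"
proof (rule measure_eqI)
  show "sets (nu \<alpha>) = sets (density (restrict_space lborel (alpha_interval \<alpha>)) (\<lambda>x. ennreal (h x)))"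
    by (simp add: sets_nu cong: sets_restrict_space_cong)
next
  fix A assume A: "A \<in> sets (nu \<alpha>)"
  then have [measurable]: "A \<in> sets borel" and sub: "A \<subseteq> alpha_interval \<alpha>" by (auto simp: sets_nu_iff)
  have "emeasure (nu \<alpha>) A
    = (\<integral>\<^sup>+x. ennreal (1 / (3 * ln golden_G)) * (ennreal (weight \<alpha> x) * indicator A x) \<partial>lborel)"
    using emeasure_nu[OF assms(1) A] by (simp add: nn_integral_cmult)
  also have "\<dots> = (\<integral>\<^sup>+x. ennreal (h x) * indicator A x * indicator (alpha_interval \<alpha>) x \<partial>lborel)"
  proof (rule nn_integral_cong_AE, use assms(3) in eventually_elim)
    case (elim x)
    then show ?case
      using sub golden_G_bounds weight_nonneg[OF assms(1), of x]
      by (auto simp: indicator_def weight_def ennreal_mult''[symmetric])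
  qed
  also have "\<dots> = emeasure (density (restrict_space lborel (alpha_interval \<alpha>)) (\<lambda>x. ennreal (h x))) A"
    using A assms(2)
    by (subst emeasure_density)
      (auto simp: nn_integral_restrict_space sets_nu cong: sets_restrict_space_cong
        intro!: measurable_restrict_space1)
  finally show "emeasure (nu \<alpha>) A = emeasure (density (restrict_space lborel (alpha_interval \<alpha>)) (\<lambda>x. ennreal (h x))) A" .
qed

text \<open>The logarithmic antiderivatives telescope at \<open>\<alpha>\<close> to
  \<open>ln (\<alpha> + golden_G - 1)\<close>, which the value at \<open>\<alpha> - 2\<close>
  cancels. The values at the cuts are \<open>- ln (1 + \<alpha> * golden_G)\<close> and
  \<open>ln (1 + \<alpha> * golden_G) - 3 * ln golden_G\<close>, so the dependence on
  \<open>\<alpha>\<close> disappears.\<close>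

lemma nn_integral_weight:
  assumes "\<alpha> \<in> {golden_g..golden_G}"
  shows "(\<integral>\<^sup>+x. ennreal (weight \<alpha> x) \<partial>lborel) = ennreal (3 * ln golden_G)"
proof -
  note b = alpha_bounds[OF assms] golden_G_bounds cut_bounds[OF assms]
  have a: "golden_G - 1 \<le> \<alpha>" "\<alpha> \<le> golden_G"
    using assms by (auto simp: golden_g_eq)
  define f1 where "f1 x = 1 / (x + golden_G + 1)" for x
  define f2 where "f2 x = 1 / (x + 1) - 1 / (x + golden_G + 1)" for x
  define f3 where "f3 x = 1 / (x + golden_G - 1) - 1 / (x + 1)" for x
  define F1 where "F1 x = ln (x + golden_G + 1)" for x
  define F2 where "F2 x = ln (x + 1) - ln (x + golden_G + 1)" for x
  define F3 where "F3 x = ln (x + golden_G - 1) - ln (x + 1)" for x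
  have meas [measurable]: "f1 \<in> borel_measurable borel" "f2 \<in> borel_measurable borel" "f3 \<in> borel_measurable borel"
    unfolding f1_def f2_def f3_def by measurable
  have n1: "0 \<le> f1 x" if "\<alpha> - 2 \<le> x" for x using a b that by (simp add: f1_def)
  have n2: "0 \<le> f2 x" if "upper_cut \<alpha> \<le> x" for x
    using a b that by (simp add: f2_def divide_simps)
  have n3: "0 \<le> f3 x" if "lower_cut \<alpha> \<le> x" for x
    using a b that by (simp add: f3_def divide_simps)
  have d1: "(F1 has_real_derivative f1 x) (at x within S)" if "\<alpha> - 2 \<le> x" for x S
    unfolding F1_def f1_def using a b that by (auto intro!: derivative_eq_intros)
  have d2: "(F2 has_real_derivative f2 x) (at x within S)" if "upper_cut \<alpha> \<le> x" for x S
    unfolding F2_def f2_def using a b that by (auto intro!: derivative_eq_intros)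
  have d3: "(F3 has_real_derivative f3 x) (at x within S)" if "lower_cut \<alpha> \<le> x" for x S
    unfolding F3_def f3_def using a b that by (auto intro!: derivative_eq_intros)
  have "AE x in lborel. ennreal (weight \<alpha> x) = ennreal (f1 x) * indicator {\<alpha> - 2..\<alpha>} x
     + ennreal (f2 x) * indicator {upper_cut \<alpha>..\<alpha>} x + ennreal (f3 x) * indicator {lower_cut \<alpha>..\<alpha>} x"
    using AE_lborel_singleton[of \<alpha>] AE_lborel_singleton[of "upper_cut \<alpha>"]
  proof eventually_elim
    case (elim x)
    show ?case
    proof (cases "x \<in> alpha_interval \<alpha>")
      case True
      have "weight \<alpha> x = f1 x + f2 x * indicator {upper_cut \<alpha>..\<alpha>} x + f3 x * indicator {lower_cut \<alpha>..\<alpha>} x"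
        using True elim by (auto simp: weight_def fibre_mass_def f1_def f2_def f3_def alpha_interval_def)
      then show ?thesis
        using True n1[of x] n2[of x] n3[of x]
        by (auto simp: alpha_interval_def indicator_def ennreal_plus[symmetric] simp del: ennreal_plus)
    qed (use elim b in \<open>auto simp: weight_def alpha_interval_def indicator_def\<close>)
  qed
  then have "(\<integral>\<^sup>+x. ennreal (weight \<alpha> x) \<partial>lborel) = (\<integral>\<^sup>+x. ennreal (f1 x) * indicator {\<alpha> - 2..\<alpha>} x
     + ennreal (f2 x) * indicator {upper_cut \<alpha>..\<alpha>} x + ennreal (f3 x) * indicator {lower_cut \<alpha>..\<alpha>} x \<partial>lborel)"
    by (rule nn_integral_cong_AE)
  also have "\<dots> = (\<integral>\<^sup>+x. ennreal (f1 x) * indicator {\<alpha> - 2..\<alpha>} x \<partial>lborel)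
     + (\<integral>\<^sup>+x. ennreal (f2 x) * indicator {upper_cut \<alpha>..\<alpha>} x \<partial>lborel)
     + (\<integral>\<^sup>+x. ennreal (f3 x) * indicator {lower_cut \<alpha>..\<alpha>} x \<partial>lborel)"
    by (simp add: nn_integral_add)
  also have "(\<integral>\<^sup>+x. ennreal (f1 x) * indicator {\<alpha> - 2..\<alpha>} x \<partial>lborel) = ennreal (F1 \<alpha> - F1 (\<alpha> - 2))"
    using b d1 n1 by (intro nn_integral_FTC_Icc) auto
  also have "(\<integral>\<^sup>+x. ennreal (f2 x) * indicator {upper_cut \<alpha>..\<alpha>} x \<partial>lborel) = ennreal (F2 \<alpha> - F2 (upper_cut \<alpha>))"
    using b d2 n2 by (intro nn_integral_FTC_Icc) auto
  also have "(\<integral>\<^sup>+x. ennreal (f3 x) * indicator {lower_cut \<alpha>..\<alpha>} x \<partial>lborel) = ennreal (F3 \<alpha> - F3 (lower_cut \<alpha>))"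
    using b d3 n3 by (intro nn_integral_FTC_Icc) auto
  also have "ennreal (F1 \<alpha> - F1 (\<alpha> - 2)) + ennreal (F2 \<alpha> - F2 (upper_cut \<alpha>)) + ennreal (F3 \<alpha> - F3 (lower_cut \<alpha>))
    = ennreal (F1 \<alpha> - F1 (\<alpha> - 2) + (F2 \<alpha> - F2 (upper_cut \<alpha>)) + (F3 \<alpha> - F3 (lower_cut \<alpha>)))"
  proof -
    \<comment> \<open>Each difference must be nonnegative before the \<open>ennreal\<close> sums can
      be merged into a real sum.\<close>
    have "F1 (\<alpha> - 2) \<le> F1 \<alpha>"
    proof (rule DERIV_nonneg_imp_nondecreasing[where f = F1])
      fix x assume "\<alpha> - 2 \<le> x"
      then show "\<exists>D. (F1 has_real_derivative D) (at x) \<and> 0 \<le> D" using d1 n1 by blast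
    qed simp
    moreover have "F2 (upper_cut \<alpha>) \<le> F2 \<alpha>"
    proof (rule DERIV_nonneg_imp_nondecreasing[where f = F2])
      fix x assume "upper_cut \<alpha> \<le> x"
      then show "\<exists>D. (F2 has_real_derivative D) (at x) \<and> 0 \<le> D" using d2 n2 by blast
    qed (use b in simp)
    moreover have "F3 (lower_cut \<alpha>) \<le> F3 \<alpha>"
    proof (rule DERIV_nonneg_imp_nondecreasing[where f = F3])
      fix x assume "lower_cut \<alpha> \<le> x"
      then show "\<exists>D. (F3 has_real_derivative D) (at x) \<and> 0 \<le> D" using d3 n3 by blast
    qed (use b in simp)
    ultimately show ?thesis by (simp add: ennreal_plus[symmetric] del: ennreal_plus)
  qed
  also have "F1 \<alpha> - F1 (\<alpha> - 2) + (F2 \<alpha> - F2 (upper_cut \<alpha>)) + (F3 \<alpha> - F3 (lower_cut \<alpha>)) = 3 * ln golden_G"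
  proof -
    have u1: "upper_cut \<alpha> + 1 = 1 / \<alpha>"
      using b by (simp add: upper_cut_def field_simps)
    have u2: "upper_cut \<alpha> + golden_G + 1 = (1 + \<alpha> * golden_G) / \<alpha>"
      using b by (simp add: upper_cut_def field_simps)
    have l1: "lower_cut \<alpha> + 1 = 1 / (2 - \<alpha>)"
      using b by (simp add: lower_cut_def field_simps)
    have cube: "golden_G ^ 3 = 2 * golden_G + 1"
      using golden_G_square by (simp add: power3_eq_cube algebra_simps)
    have "golden_G ^ 3 * (\<alpha> - 1 + (golden_G - 1) * (2 - \<alpha>)) = 1 + \<alpha> * golden_G"
    proof -
      have sq: "golden_G * (golden_G * t) = golden_G * t + t" for t
        using golden_G_square by (metis distrib_right mult.assoc mult_1)
      then show ?thesis
        unfolding cube by (simp add: algebra_simps golden_G_square sq)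
    qed
    then have "\<alpha> - 1 + (golden_G - 1) * (2 - \<alpha>) = (1 + \<alpha> * golden_G) / golden_G ^ 3"
      using b by (simp add: eq_divide_eq mult.commute)
    moreover have "lower_cut \<alpha> + golden_G - 1 = (\<alpha> - 1 + (golden_G - 1) * (2 - \<alpha>)) / (2 - \<alpha>)"
      using b by (simp add: lower_cut_def field_simps)
    ultimately have l2: "lower_cut \<alpha> + golden_G - 1 = (1 + \<alpha> * golden_G) / (golden_G ^ 3 * (2 - \<alpha>))"
      by simp
    have "0 < 1 + \<alpha> * golden_G" using b by (simp add: add_pos_pos)
    then show ?thesis
      using b unfolding F1_def F2_def F3_def u1 u2 l1 l2
      by (simp add: ln_div ln_mult ln_realpow)
  qed
  finally show ?thesis .
qed

subsection \<open>Invariance\<close>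

lemma phi_measurable [measurable]: "phi \<alpha> \<in> borel_measurable borel"
  unfolding phi_def alpha_digit_def by (simp del: of_int_mult of_int_floor_cancel)

text \<open>If \<open>t\<close> is the argument of the floor in the digit,
  \<open>phi \<alpha> x\<close> is twice the fractional part of \<open>t\<close>, shifted by
  \<open>\<alpha> - 2\<close>.\<close>

lemma phi_in_alpha_interval:
  assumes "\<alpha> \<in> {golden_g..golden_G}"
  shows "phi \<alpha> x \<in> alpha_interval \<alpha>"
proof (cases "x = 0")
  case True
  then show ?thesis using alpha_bounds[OF assms] by (simp add: phi_def alpha_interval_def)
next
  case False
  define t where "t = 1 / (2 * \<bar>x\<bar>) + (1 - \<alpha>) / 2"
  define k where "k = real_of_int \<lfloor>t\<rfloor>"
  have "phi \<alpha> x = 2 * (t - k) + \<alpha> - 2"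
    using False by (simp add: phi_def alpha_digit_def k_def t_def field_simps)
  moreover have "k \<le> t" "t < k + 1" unfolding k_def by linarith+
  ultimately show ?thesis unfolding alpha_interval_def by simp
qed

text \<open>The argument of the floor is \<open>n + (y + 2 - \<alpha>) / 2\<close>, and membership
  of \<open>y\<close> in the interval puts the second summand in \<open>[0, 1)\<close>.\<close>

lemma phi_inverse_branch:
  assumes "y \<in> alpha_interval \<alpha>" "0 < y + 2 * real n + 1" "\<bar>x\<bar> = 1 / (y + 2 * real n + 1)"
  shows "phi \<alpha> x = y"
proof -
  have "\<lfloor>1 / (2 * \<bar>x\<bar>) + (1 - \<alpha>) / 2\<rfloor> = int n"
    unfolding assms(3) using assms(1,2) by (intro floor_unique) (auto simp: alpha_interval_def field_simps)
  moreover have "x \<noteq> 0" using assms(2,3) by auto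
  ultimately show ?thesis using assms(2,3) by (simp add: phi_def alpha_digit_def)
qed

section \<open>Change of variables along the inverse branches\<close>

text \<open>The reciprocal maps the positive half line onto itself. The substitution is carried out
  for absolutely integrable functions, hence the integrability assumption, and nonnegativity leads
  back to \<open>nn_integral\<close>.\<close>

lemma nn_integral_reciprocal_substitution:
  fixes F :: "real \<Rightarrow> real"
  assumes F: "integrable lborel F" and nonneg: "\<And>x. 0 \<le> F x"
  shows "(\<integral>\<^sup>+x. ennreal (F x) * indicator {0<..} x \<partial>lborel)
    = (\<integral>\<^sup>+z. ennreal (F (1 / z) / z\<^sup>2) * indicator {0<..} z \<partial>lborel)"
proof -
  let ?S = "{0<..} :: real set"
  have im: "(\<lambda>z. 1 / z) ` ?S = ?S"
  proof (intro equalityI subsetI)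
    fix x :: real assume "x \<in> ?S"
    then show "x \<in> (\<lambda>z. 1 / z) ` ?S" by (intro image_eqI[of _ _ "1 / x"]) auto
  qed auto
  have "integrable lebesgue F"
    using F by (simp add: integrable_completion borel_measurable_integrable)
  then have FS: "F absolutely_integrable_on ?S"
    unfolding set_integrable_def by (intro integrable_mult_indicator) auto
  then have I: "F integrable_on ?S"
    by (rule set_lebesgue_integral_eq_integral)
  have "(\<lambda>z. \<bar>- (1 / z\<^sup>2)\<bar> * F (1 / z)) absolutely_integrable_on ?S \<and>
      integral ?S (\<lambda>z. \<bar>- (1 / z\<^sup>2)\<bar> * F (1 / z)) = integral ?S F
      \<longleftrightarrow> F absolutely_integrable_on (\<lambda>z. 1 / z) ` ?S \<and> integral ((\<lambda>z. 1 / z) ` ?S) F = integral ?S F"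
  proof (rule has_absolute_integral_change_of_variables_1')
    show "inj_on (\<lambda>z. 1 / z) ?S" by (auto simp: inj_on_def)
    show "((\<lambda>z. 1 / z) has_real_derivative - (1 / z\<^sup>2)) (at z within ?S)" if "z \<in> ?S" for z
      using that by (auto intro!: derivative_eq_intros simp: power2_eq_square)
  qed simp
  then have J: "((\<lambda>z. F (1 / z) / z\<^sup>2) has_integral integral ?S F) ?S"
    unfolding im using FS by (auto dest: set_lebesgue_integral_eq_integral(1) simp: has_integral_iff)
  show ?thesis
    using nn_integral_has_integral_lebesgue'[OF _ J] nn_integral_has_integral_lebesgue'[OF _ integrable_integral[OF I]] nonneg
    by simp
qed

lemma nn_integral_reciprocal_branches:
  fixes F :: "real \<Rightarrow> real"
  assumes F: "integrable lborel F" and nonneg: "\<And>x. 0 \<le> F x"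
  shows "(\<integral>\<^sup>+x. ennreal (F x) \<partial>lborel)
    = (\<integral>\<^sup>+z. ennreal ((F (1 / z) + F (- 1 / z)) / z\<^sup>2) * indicator {0<..} z \<partial>lborel)"
proof -
  have [measurable]: "F \<in> borel_measurable borel" using F by (simp add: borel_measurable_integrable)
  have F': "integrable lborel (\<lambda>x. F (- x))"
    using lborel_integrable_real_affine[OF F, of "-1" 0] by simp
  have "(\<integral>\<^sup>+x. ennreal (F x) \<partial>lborel)
      = (\<integral>\<^sup>+x. ennreal (F x) * indicator {0<..} x + ennreal (F x) * indicator {..<0} x \<partial>lborel)"
    by (rule nn_integral_cong_AE, use AE_lborel_singleton[of 0] in eventually_elim)
      (auto simp: indicator_def)
  also have "\<dots> = (\<integral>\<^sup>+x. ennreal (F x) * indicator {0<..} x \<partial>lborel)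
      + (\<integral>\<^sup>+x. ennreal (F x) * indicator {..<0} x \<partial>lborel)"
    by (simp add: nn_integral_add)
  also have "(\<integral>\<^sup>+x. ennreal (F x) * indicator {..<0} x \<partial>lborel)
      = (\<integral>\<^sup>+x. ennreal (F (- x)) * indicator {0<..} x \<partial>lborel)"
    by (subst nn_integral_real_affine[where c = "-1" and t = 0]) (auto intro!: nn_integral_cong simp: indicator_def)
  also have "(\<integral>\<^sup>+x. ennreal (F (- x)) * indicator {0<..} x \<partial>lborel)
      = (\<integral>\<^sup>+z. ennreal (F (- (1 / z)) / z\<^sup>2) * indicator {0<..} z \<partial>lborel)"
    by (rule nn_integral_reciprocal_substitution[OF F']) (rule nonneg)
  also have "(\<integral>\<^sup>+x. ennreal (F x) * indicator {0<..} x \<partial>lborel)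
      = (\<integral>\<^sup>+z. ennreal (F (1 / z) / z\<^sup>2) * indicator {0<..} z \<partial>lborel)"
    by (rule nn_integral_reciprocal_substitution[OF F nonneg])
  also have "(\<integral>\<^sup>+z. ennreal (F (1 / z) / z\<^sup>2) * indicator {0<..} z \<partial>lborel)
      + (\<integral>\<^sup>+z. ennreal (F (- (1 / z)) / z\<^sup>2) * indicator {0<..} z \<partial>lborel)
      = (\<integral>\<^sup>+z. ennreal (F (1 / z) / z\<^sup>2) * indicator {0<..} z
        + ennreal (F (- (1 / z)) / z\<^sup>2) * indicator {0<..} z \<partial>lborel)"
    by (rule nn_integral_add[symmetric]) auto
  also have "\<dots> = (\<integral>\<^sup>+z. ennreal ((F (1 / z) + F (- 1 / z)) / z\<^sup>2) * indicator {0<..} z \<partial>lborel)"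
    using nonneg by (intro nn_integral_cong) (auto simp: indicator_def add_divide_distrib)
  finally show ?thesis .
qed

text \<open>The interval has length 2, so its translates by the odd numbers \<open>2 * n + 1\<close>
  tile \<open>[\<alpha> - 1, \<infinity>)\<close>.\<close>

lemma nn_integral_alpha_tiling:
  assumes [measurable]: "K \<in> borel_measurable borel" and zero: "\<And>z. z < \<alpha> - 1 \<Longrightarrow> K z = 0"
  shows "(\<integral>\<^sup>+z. K z \<partial>lborel)
    = (\<integral>\<^sup>+y. (\<Sum>n. K (y + 2 * real n + 1)) * indicator (alpha_interval \<alpha>) y \<partial>lborel)"
proof -
  have tile: "K z = (\<Sum>n. K z * indicator (alpha_interval \<alpha>) (z - (2 * real n + 1)))" for z
  proof (cases "z < \<alpha> - 1")
    case False
    \<comment> \<open>The index of the unique tile containing \<open>z\<close>.\<close>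
    define m where "m = nat \<lfloor>(z + 1 - \<alpha>) / 2\<rfloor>"
    have "real m = of_int \<lfloor>(z + 1 - \<alpha>) / 2\<rfloor>"
      using False unfolding m_def by simp
    then have m: "real m \<le> (z + 1 - \<alpha>) / 2" "(z + 1 - \<alpha>) / 2 < real m + 1" by linarith+
    have "z - (2 * real n + 1) \<in> alpha_interval \<alpha> \<longleftrightarrow> n = m" for n
    proof
      assume "z - (2 * real n + 1) \<in> alpha_interval \<alpha>"
      then have "real n < real m + 1" "real m < real n + 1"
        using m unfolding alpha_interval_def by auto
      then show "n = m" by linarith
    qed (use m in \<open>auto simp: alpha_interval_def\<close>)
    then have "(\<lambda>n. K z * indicator (alpha_interval \<alpha>) (z - (2 * real n + 1)))
      = (\<lambda>n. if n = m then K z else 0)"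
      by (auto simp: indicator_def)
    then show ?thesis using sums_single[of m "\<lambda>_. K z"] by (simp add: sums_iff)
  qed (simp add: zero)
  have "(\<integral>\<^sup>+z. K z \<partial>lborel)
      = (\<integral>\<^sup>+z. (\<Sum>n. K z * indicator (alpha_interval \<alpha>) (z - (2 * real n + 1))) \<partial>lborel)"
    by (subst tile) simp
  also have "\<dots> = (\<Sum>n. \<integral>\<^sup>+z. K z * indicator (alpha_interval \<alpha>) (z - (2 * real n + 1)) \<partial>lborel)"
    by (rule nn_integral_suminf) auto
  also have "\<dots> = (\<Sum>n. \<integral>\<^sup>+y. K (y + 2 * real n + 1) * indicator (alpha_interval \<alpha>) y \<partial>lborel)"
  proof (rule suminf_cong)
    fix n
    show "(\<integral>\<^sup>+z. K z * indicator (alpha_interval \<alpha>) (z - (2 * real n + 1)) \<partial>lborel)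
      = (\<integral>\<^sup>+y. K (y + 2 * real n + 1) * indicator (alpha_interval \<alpha>) y \<partial>lborel)"
      by (subst nn_integral_real_affine[where c = 1 and t = "2 * real n + 1"])
        (auto simp: add_ac)
  qed
  also have "\<dots> = (\<integral>\<^sup>+y. (\<Sum>n. K (y + 2 * real n + 1) * indicator (alpha_interval \<alpha>) y) \<partial>lborel)"
    by (rule nn_integral_suminf[symmetric]) auto
  also have "\<dots> = (\<integral>\<^sup>+y. (\<Sum>n. K (y + 2 * real n + 1)) * indicator (alpha_interval \<alpha>) y \<partial>lborel)"
    by simp
  finally show ?thesis .
qed

text \<open>Handles the points below the first tile: their reciprocals lie beyond the ends of the
  interval.\<close>

lemma weight_reciprocal_eq_0:
  assumes "\<alpha> \<in> {golden_g..golden_G}" "0 < z" "z < \<alpha> - 1"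
  shows "weight \<alpha> (1 / z) = 0" "weight \<alpha> (- 1 / z) = 0"
proof -
  note b = alpha_bounds[OF assms(1)]
  have "\<alpha> * z < \<alpha> * (\<alpha> - 1)" using assms b by (intro mult_strict_left_mono) auto
  then have "\<alpha> * z < 1" using b by (simp add: algebra_simps)
  then have "\<alpha> < 1 / z" using assms by (simp add: field_simps)
  \<comment> \<open>\<open>0 < z\<close> and \<open>z < \<alpha> - 1\<close> force
    \<open>\<alpha> > 1\<close>, so both factors are below 1.\<close>
  moreover have "(2 - \<alpha>) * z < 1 * 1" using assms b by (intro mult_strict_mono) auto
  then have "- 1 / z < \<alpha> - 2" using assms by (simp add: field_simps)
  ultimately show "weight \<alpha> (1 / z) = 0" "weight \<alpha> (- 1 / z) = 0"
    by (auto simp: weight_def alpha_interval_def)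
qed

lemma integrable_weight:
  assumes "\<alpha> \<in> {golden_g..golden_G}"
  shows "integrable lborel (weight \<alpha>)"
  by (rule integrableI_nonneg) (auto simp: nn_integral_weight[OF assms] weight_nonneg[OF assms])

text \<open>On the tile with index \<open>n\<close> both reciprocals of \<open>y + 2 * n + 1\<close>
  are preimages of \<open>y\<close>, so the indicator of \<open>A\<close> depends on
  \<open>y\<close> alone and factors out of the branch sum, which is then the fixed-point
  identity.\<close>

lemma weight_invariant:
  assumes "\<alpha> \<in> {golden_g..golden_G}" and [measurable]: "A \<in> sets borel"
  shows "(\<integral>\<^sup>+x. ennreal (weight \<alpha> x) * indicator A (phi \<alpha> x) \<partial>lborel)
    = (\<integral>\<^sup>+y. ennreal (weight \<alpha> y) * indicator A y \<partial>lborel)"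
proof -
  define F where "F x = weight \<alpha> x * indicator A (phi \<alpha> x)" for x
  have F_nonneg: "0 \<le> F x" for x using weight_nonneg[OF assms(1)] by (simp add: F_def)
  have F_meas [measurable]: "F \<in> borel_measurable borel" unfolding F_def by measurable
  have F_int: "integrable lborel F"
    by (rule Bochner_Integration.integrable_bound[OF integrable_weight[OF assms(1)]])
      (auto simp: F_def indicator_def)
  define K where "K z = ennreal ((F (1 / z) + F (- 1 / z)) / z\<^sup>2) * indicator {0<..} z" for z
  have [measurable]: "K \<in> borel_measurable borel" unfolding K_def by measurable
  have K_zero: "K z = 0" if "z < \<alpha> - 1" for z
    using weight_reciprocal_eq_0[OF assms(1) _ that] by (auto simp: K_def F_def indicator_def)
  have K_branch: "K (y + 2 * real n + 1) = ennreal (branch_term \<alpha> (y + 2 * real n + 1)) * indicator A y"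
    if y: "y \<in> alpha_interval \<alpha>" for y n
  proof (cases "0 < y + 2 * real n + 1")
    case True
    then have "phi \<alpha> (1 / (y + 2 * real n + 1)) = y" "phi \<alpha> (- 1 / (y + 2 * real n + 1)) = y"
      using y by (auto intro!: phi_inverse_branch)
    then show ?thesis
      using True by (simp add: K_def F_def branch_term_def indicator_def)
  qed (simp add: K_def branch_term_def)
  have "(\<integral>\<^sup>+x. ennreal (weight \<alpha> x) * indicator A (phi \<alpha> x) \<partial>lborel) = (\<integral>\<^sup>+x. ennreal (F x) \<partial>lborel)"
    by (auto intro!: nn_integral_cong simp: F_def indicator_def)
  also have "\<dots> = (\<integral>\<^sup>+z. K z \<partial>lborel)"
    unfolding K_def by (rule nn_integral_reciprocal_branches[OF F_int F_nonneg])
  also have "\<dots> = (\<integral>\<^sup>+y. (\<Sum>n. K (y + 2 * real n + 1)) * indicator (alpha_interval \<alpha>) y \<partial>lborel)"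
    by (rule nn_integral_alpha_tiling[OF _ K_zero]) auto
  also have "\<dots> = (\<integral>\<^sup>+y. ennreal (weight \<alpha> y) * indicator A y \<partial>lborel)"
  proof (rule nn_integral_cong_AE, use AE_lborel_singleton[of "\<alpha> - 2"] in eventually_elim)
    case (elim y)
    show ?case
    proof (cases "y \<in> alpha_interval \<alpha>")
      case True
      then have "(\<lambda>n. branch_term \<alpha> (y + 2 * real n + 1)) sums weight \<alpha> y"
        using elim by (intro transfer_operator_weight[OF assms(1)]) (auto simp: alpha_interval_def)
      then have "(\<Sum>n. ennreal (branch_term \<alpha> (y + 2 * real n + 1))) = ennreal (weight \<alpha> y)"
        by (auto simp: sums_iff suminf_ennreal2 branch_term_nonneg[OF assms(1)])
      then show ?thesis using True by (simp add: K_branch)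
    qed (simp add: weight_def)
  qed
  finally show ?thesis .
qed

lemma prob_space_nu:
  assumes "\<alpha> \<in> {golden_g..golden_G}"
  shows "prob_space (nu \<alpha>)"
proof (rule prob_spaceI)
  have "alpha_interval \<alpha> \<in> sets (nu \<alpha>)" by (simp add: sets_nu_iff)
  then have "emeasure (nu \<alpha>) (alpha_interval \<alpha>) = ennreal (1 / (3 * ln golden_G))
      * (\<integral>\<^sup>+x. ennreal (weight \<alpha> x) * indicator (alpha_interval \<alpha>) x \<partial>lborel)"
    by (rule emeasure_nu[OF assms])
  also have "(\<integral>\<^sup>+x. ennreal (weight \<alpha> x) * indicator (alpha_interval \<alpha>) x \<partial>lborel) = ennreal (3 * ln golden_G)"
    unfolding nn_integral_weight[OF assms, symmetric]
    by (intro nn_integral_cong) (auto simp: weight_def indicator_def)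
  finally show "emeasure (nu \<alpha>) (space (nu \<alpha>)) = 1"
    using golden_G_bounds by (simp add: ennreal_mult''[symmetric])
qed

lemma phi_measurable_nu:
  assumes "\<alpha> \<in> {golden_g..golden_G}"
  shows "phi \<alpha> \<in> measurable (nu \<alpha>) (nu \<alpha>)"
proof -
  have "phi \<alpha> \<in> measurable (restrict_space borel (alpha_interval \<alpha>)) (restrict_space borel (alpha_interval \<alpha>))"
    using phi_in_alpha_interval[OF assms]
    by (intro measurable_restrict_space2 measurable_restrict_space1) auto
  then show ?thesis by (simp cong: measurable_cong_sets[OF sets_nu sets_nu])
qed

lemma distr_nu_phi:
  assumes "\<alpha> \<in> {golden_g..golden_G}"
  shows "distr (nu \<alpha>) (nu \<alpha>) (phi \<alpha>) = nu \<alpha>"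
proof (rule measure_eqI)
  fix A assume "A \<in> sets (distr (nu \<alpha>) (nu \<alpha>) (phi \<alpha>))"
  then have A: "A \<in> sets (nu \<alpha>)" by simp
  then have A': "A \<in> sets borel" by (simp add: sets_nu_iff)
  let ?B = "phi \<alpha> -` A \<inter> alpha_interval \<alpha>"
  have "emeasure (distr (nu \<alpha>) (nu \<alpha>) (phi \<alpha>)) A = emeasure (nu \<alpha>) ?B"
    by (simp add: emeasure_distr phi_measurable_nu[OF assms] A)
  also have "\<dots> = ennreal (1 / (3 * ln golden_G)) * (\<integral>\<^sup>+x. ennreal (weight \<alpha> x) * indicator ?B x \<partial>lborel)"
    using measurable_sets[OF phi_measurable_nu[OF assms] A] by (intro emeasure_nu[OF assms]) simp
  \<comment> \<open>Intersecting the preimage with the interval changes nothing, as the weight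
    vanishes outside.\<close>
  also have "(\<integral>\<^sup>+x. ennreal (weight \<alpha> x) * indicator ?B x \<partial>lborel)
      = (\<integral>\<^sup>+x. ennreal (weight \<alpha> x) * indicator A (phi \<alpha> x) \<partial>lborel)"
    by (intro nn_integral_cong) (auto simp: weight_def indicator_def)
  also have "\<dots> = (\<integral>\<^sup>+x. ennreal (weight \<alpha> x) * indicator A x \<partial>lborel)"
    by (rule weight_invariant[OF assms A'])
  finally show "emeasure (distr (nu \<alpha>) (nu \<alpha>) (phi \<alpha>)) A = emeasure (nu \<alpha>) A"
    by (simp add: emeasure_nu[OF assms A])
qed simp

theorem corollary12:
  fixes \<alpha> :: real
  assumes "\<alpha> \<in> {golden_g..golden_G}"
  shows "prob_space (nu \<alpha>)
    \<and> phi \<alpha> \<in> measurable (nu \<alpha>) (nu \<alpha>)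
    \<and> distr (nu \<alpha>) (nu \<alpha>) (phi \<alpha>) = nu \<alpha>
    \<and> (\<alpha> \<le> 1 \<longrightarrow>
        nu \<alpha> = density (restrict_space lborel (alpha_interval \<alpha>)) (\<lambda>x. ennreal (density_le_1 \<alpha> x)))
    \<and> (1 \<le> \<alpha> \<longrightarrow>
        nu \<alpha> = density (restrict_space lborel (alpha_interval \<alpha>)) (\<lambda>x. ennreal (density_ge_1 \<alpha> x)))"
proof (intro conjI impI)
  note b = alpha_bounds[OF assms]
  show "prob_space (nu \<alpha>)" "phi \<alpha> \<in> measurable (nu \<alpha>) (nu \<alpha>)" "distr (nu \<alpha>) (nu \<alpha>) (phi \<alpha>) = nu \<alpha>"
    by (rule prob_space_nu[OF assms] phi_measurable_nu[OF assms] distr_nu_phi[OF assms])+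
  show "nu \<alpha> = density (restrict_space lborel (alpha_interval \<alpha>)) (\<lambda>x. ennreal (density_le_1 \<alpha> x))"
    if "\<alpha> \<le> 1"
  proof (rule nu_eq_density[OF assms])
    show "density_le_1 \<alpha> \<in> borel_measurable borel" unfolding density_le_1_def by measurable
    \<comment> \<open>The signs order the cuts: the lower one comes first, and all three summands
      are present past both.\<close>
    have "lower_cut \<alpha> \<le> 0" "0 \<le> upper_cut \<alpha>"
      using b that by (simp_all add: lower_cut_def upper_cut_def field_simps)
    then show "AE x in lborel. x \<in> alpha_interval \<alpha> \<longrightarrow>
        density_le_1 \<alpha> x = 1 / (3 * ln golden_G) * fibre_mass \<alpha> x"
      unfolding density_le_1_def fibre_mass_def alpha_interval_def
        lower_cut_def[symmetric] upper_cut_def[symmetric]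
      by (intro eventually_mono[OF AE_lborel_singleton[of "upper_cut \<alpha>"]]) auto
  qed
  show "nu \<alpha> = density (restrict_space lborel (alpha_interval \<alpha>)) (\<lambda>x. ennreal (density_ge_1 \<alpha> x))"
    if "1 \<le> \<alpha>"
  proof (rule nu_eq_density[OF assms])
    show "density_ge_1 \<alpha> \<in> borel_measurable borel" unfolding density_ge_1_def by measurable
    \<comment> \<open>Now the upper cut comes first; between the cuts the first two summands
      collapse to \<open>1 / (x + 1)\<close>.\<close>
    have "0 \<le> lower_cut \<alpha>" "upper_cut \<alpha> \<le> 0"
      using b that by (simp_all add: lower_cut_def upper_cut_def field_simps)
    then show "AE x in lborel. x \<in> alpha_interval \<alpha> \<longrightarrow>
        density_ge_1 \<alpha> x = 1 / (3 * ln golden_G) * fibre_mass \<alpha> x"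
      unfolding density_ge_1_def fibre_mass_def alpha_interval_def
        lower_cut_def[symmetric] upper_cut_def[symmetric]
      by (intro eventually_mono[OF AE_lborel_singleton[of "upper_cut \<alpha>"]]) auto
  qed
qed

end
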